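(* Let $N\ge 2$ and $T\ge 1$ be integers, and let $l_{i,t}$ (losses) and $\lambda_{i,t}$ (lower bounds), $1\le i\le N$, $1\le t\le T$, be real numbers with $\lambda_{i,t}\le l_{i,t}$, fixed in advance (oblivious adversary). Put $s_{i,t}=l_{i,t}-\lambda_{i,t}$, $\mathbf{s}_t=(s_{1,t},\ldots,s_{N,t})$ and $\boldsymbol{\lambda}_t=(\lambda_{1,t},\ldots,\lambda_{N,t})$. If $\mathcal{Q}'>0$ is an upper bound on $$4\Big(q(\boldsymbol{\lambda}_{1:T}) + \sum_{t=1}^T\|\mathbf{s}_t\|^2\Big),$$ then the algorithm Exp3.LB run with $\eta = \sqrt{4\log N/\mathcal{Q}'}$ satisfies $$\mathbb{E}\, R_{Exp3.LB,T} \leq \sqrt{\mathcal{Q}' \log N}.$$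
   Context: Notation: $\|\cdot\|$ is the Euclidean norm; for $\mathbf{x}\in\mathbb{R}^N$, $d(\mathbf{x})=\max_i\{x_i\}-\min_i\{x_i\}$; for vectors $\mathbf{x}_1,\ldots,\mathbf{x}_T\in\mathbb{R}^N$, $q(\mathbf{x}_{1:T})=\sum_{t=1}^T d(\mathbf{x}_t)^2$; $\log$ is the natural logarithm. Model: there are $N$ experts and $T$ rounds. On each round $t$ the learner picks a probability distribution $\mathbf{p}_t$ on $\{1,\ldots,N\}$ (depending on past observations), draws $I_t\sim\mathbf{p}_t$ (conditionally on the past), incurs loss $l_{I_t,t}$, and observes $l_{I_t,t}$ and all of $\lambda_{1,t},\ldots,\lambda_{N,t}$. Exp3.LB with parameter $\eta>0$: $\mathbf{p}_1$ is uniform and $\widetilde{L}_{i,0}=0$ for all $i$. On each round $t=1,\ldots,T$: draw $I_t\sim\mathbf{p}_t$; set $\widetilde{l}_{i,t} = \frac{s_{i,t}}{p_{i,t}}\mathbb{I}\{I_t=i\}+\lambda_{i,t}$ and $\widetilde{L}_{i,t}=\widetilde{L}_{i,t-1}+\widetilde{l}_{i,t}$ for every $i$; set $p_{i,t+1}=\exp(-\eta \widetilde{L}_{i,t})/\sum_{k=1}^N\exp(-\eta\widetilde{L}_{k,t})$. The regret is $R_{Exp3.LB,T}=\sum_{t=1}^T l_{I_t,t}-\min_j\sum_{t=1}^T l_{j,t}$. *)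

theory Defs
  imports "HOL-Probability.Probability"
begin

text \<open>Experts are the elements of a finite type; a vector in \<open>real ^ 'n\<close> holds one value per
  expert. Sequences are functions on \<open>nat\<close> of which only the rounds \<open>1, \<dots>, T\<close> are used.\<close>

definition vec_range :: "real ^ 'n \<Rightarrow> real" where
  "vec_range x = (MAX i. x $ i) - (MIN i. x $ i)"

definition quad_range :: "(nat \<Rightarrow> real ^ 'n) \<Rightarrow> nat \<Rightarrow> real" where
  "quad_range x T = (\<Sum>t=1..T. (vec_range (x t))\<^sup>2)"

definition exp_weights :: "real \<Rightarrow> real ^ 'n \<Rightarrow> 'n \<Rightarrow> real" where
  "exp_weights \<eta> L i = exp (- \<eta> * L $ i) / (\<Sum>k\<in>UNIV. exp (- \<eta> * L $ k))"

text \<open>In the following, \<open>l\<close> are the losses, \<open>lam\<close> the lower bounds and \<open>I t\<close> the expert drawn in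
  round \<open>t\<close>. \<open>exp3lb_cum \<eta> l lam I t\<close> is the vector of cumulative estimates after round \<open>t\<close>; it
  depends on \<open>I 1, \<dots>, I t\<close> only.\<close>

primrec exp3lb_cum ::
  "real \<Rightarrow> (nat \<Rightarrow> real ^ 'n) \<Rightarrow> (nat \<Rightarrow> real ^ 'n) \<Rightarrow> (nat \<Rightarrow> 'n) \<Rightarrow> nat \<Rightarrow> real ^ 'n" where
  "exp3lb_cum \<eta> l lam I 0 = 0"
| "exp3lb_cum \<eta> l lam I (Suc t) = exp3lb_cum \<eta> l lam I t +
     (\<chi> i. (l (Suc t) $ i - lam (Suc t) $ i) / exp_weights \<eta> (exp3lb_cum \<eta> l lam I t) i
             * (if I (Suc t) = i then 1 else 0)
           + lam (Suc t) $ i)"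

text \<open>The distribution used in round \<open>t + 1\<close> is \<open>exp_weights \<eta> (exp3lb_cum \<eta> l lam I t)\<close>; for
  \<open>t = 0\<close> it is uniform:\<close>

lemma exp_weights_0: "exp_weights \<eta> (0 :: real ^ 'n) i = 1 / real CARD('n)"
  by (simp add: exp_weights_def)

definition exp_weights_pmf :: "real \<Rightarrow> real ^ 'n \<Rightarrow> 'n pmf" where
  "exp_weights_pmf \<eta> L = embed_pmf (exp_weights \<eta> L)"

lemma pmf_exp_weights_pmf: "pmf (exp_weights_pmf \<eta> L) i = exp_weights \<eta> L i"
proof -
  have pos: "(\<Sum>k\<in>UNIV. exp (- \<eta> * L $ k)) > 0"
    by (intro sum_pos) auto
  have nonneg: "0 \<le> exp_weights \<eta> L j" for j
    unfolding exp_weights_def using pos by (intro divide_nonneg_pos) auto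
  have "(\<Sum>j\<in>UNIV. exp_weights \<eta> L j) = 1"
    using pos unfolding exp_weights_def sum_divide_distrib[symmetric] by simp
  then have "(\<integral>\<^sup>+j. ennreal (exp_weights \<eta> L j) \<partial>count_space UNIV) = 1"
    by (simp add: nn_integral_count_space_finite sum_ennreal nonneg)
  then show ?thesis
    unfolding exp_weights_pmf_def using nonneg by (intro pmf_embed_pmf) auto
qed

text \<open>Joint law of the experts drawn in rounds \<open>1, \<dots>, t\<close>: given the first \<open>t\<close> draws, draw number
  \<open>t + 1\<close> follows the exponential weights. Entries at other indices remain \<open>undefined\<close>, so the
  support is finite.\<close>

primrec exp3lb_draws ::
  "real \<Rightarrow> (nat \<Rightarrow> real ^ 'n) \<Rightarrow> (nat \<Rightarrow> real ^ 'n) \<Rightarrow> nat \<Rightarrow> (nat \<Rightarrow> 'n) pmf" where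
  "exp3lb_draws \<eta> l lam 0 = return_pmf (\<lambda>_. undefined)"
| "exp3lb_draws \<eta> l lam (Suc t) =
     bind_pmf (exp3lb_draws \<eta> l lam t) (\<lambda>I.
       map_pmf (\<lambda>i. I(Suc t := i)) (exp_weights_pmf \<eta> (exp3lb_cum \<eta> l lam I t)))"

definition regret :: "(nat \<Rightarrow> real ^ 'n) \<Rightarrow> nat \<Rightarrow> (nat \<Rightarrow> 'n) \<Rightarrow> real" where
  "regret l T I = (\<Sum>t=1..T. l t $ I t) - (MIN j. \<Sum>t=1..T. l t $ j)"

end

theory Submission imports Defs begin

text \<open>The quantity \<open>\<Sum>u\<le>t. l\<^sub>u(I\<^sub>u) + ln (\<Sum>k. exp (- \<eta> L\<^sub>t\<^sub>k)) / \<eta>\<close>, with \<open>L\<^sub>t\<close> the vector of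
  cumulative estimates, grows in expectation by at most \<open>\<eta> (d(\<lambda>\<^sub>t)\<^sup>2 + \<parallel>s\<^sub>t\<parallel>\<^sup>2)\<close> in each round. To see
  this, shift the estimates by \<open>min \<lambda>\<^sub>t\<close>, so that they become nonnegative, apply
  \<open>exp (- y) \<le> 1 - y + y\<^sup>2 / 2\<close>, and split the square of the shifted estimate by
  \<open>(a + b)\<^sup>2 \<le> 2 a\<^sup>2 + 2 b\<^sup>2\<close>; the importance-weighted part contributes \<open>\<Sum>i. s\<^sub>i\<^sup>2\<close> in expectation.
  The estimates are unbiased and \<open>ln (\<Sum>k. exp (- \<eta> L\<^sub>k)) \<ge> - \<eta> L\<^sub>j\<close>, which compares the learner's
  expected loss with that of any fixed expert \<open>j\<close>; the choice of \<open>\<eta>\<close> balances the two terms of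
  \<open>ln N / \<eta> + \<eta> Q' / 4\<close>.\<close>

section \<open>Scalar inequalities for \<open>exp\<close> and \<open>ln\<close>\<close>

text \<open>The product of 1 - y + y^2/2 and 1 + y + y^2/2 is 1 + y^4/4, hence at least 1, and for y
  \<ge> 0 the second factor is at most exp y.\<close>

lemma exp_minus_le_quadratic:
  fixes y :: real
  assumes "0 \<le> y"
  shows "exp (- y) \<le> 1 - y + y\<^sup>2 / 2"
proof -
  have pos: "0 < 1 - y + y\<^sup>2 / 2"
    using sum_power2_gt_zero_iff[of "y - 1" 1] by (simp add: power2_eq_square algebra_simps)
  have "1 \<le> 1 + (y\<^sup>2 / 2)\<^sup>2" by simp
  also have "\<dots> = (1 - y + y\<^sup>2 / 2) * (1 + y + y\<^sup>2 / 2)"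
    by (simp add: power2_eq_square field_simps)
  also have "\<dots> \<le> (1 - y + y\<^sup>2 / 2) * exp y"
    using exp_lower_Taylor_quadratic[OF assms] pos by (intro mult_left_mono) auto
  finally show ?thesis
    by (simp add: exp_minus field_simps)
qed

text \<open>Combine ln S \<le> S - 1 with the quadratic bound in each summand; since p has total
  mass 1, the constant terms cancel.\<close>

lemma ln_sum_exp_le:
  fixes p y :: "'a \<Rightarrow> real"
  assumes "finite A" and p: "\<And>i. i \<in> A \<Longrightarrow> 0 \<le> p i" "sum p A = 1"
    and y: "\<And>i. i \<in> A \<Longrightarrow> 0 \<le> y i" and "0 < \<eta>"
  shows "ln (\<Sum>i\<in>A. p i * exp (- \<eta> * y i)) / \<eta>
    \<le> - (\<Sum>i\<in>A. p i * y i) + \<eta> / 2 * (\<Sum>i\<in>A. p i * (y i)\<^sup>2)"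
proof -
  let ?S = "\<Sum>i\<in>A. p i * exp (- \<eta> * y i)"
  \<comment> \<open>The logarithmic inequality needs S > 0. As p may vanish at some points, this has
    to come from its total mass.\<close>
  have "?S \<noteq> 0"
  proof
    assume "?S = 0"
    then have "\<forall>i\<in>A. p i = 0"
      using p by (subst (asm) sum_nonneg_eq_0_iff) (auto simp: \<open>finite A\<close>)
    then show False using p(2) by simp
  qed
  moreover have "0 \<le> ?S"
    using p by (intro sum_nonneg) auto
  ultimately have "ln ?S \<le> ?S - 1"
    by (intro ln_le_minus_one) linarith
  also have "?S \<le> (\<Sum>i\<in>A. p i * (1 - \<eta> * y i + (\<eta> * y i)\<^sup>2 / 2))"
    using exp_minus_le_quadratic[of "\<eta> * y _"] p y \<open>0 < \<eta>\<close>
    by (intro sum_mono mult_left_mono) auto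
  also have "\<dots> = sum p A - \<eta> * (\<Sum>i\<in>A. p i * y i) + \<eta>\<^sup>2 / 2 * (\<Sum>i\<in>A. p i * (y i)\<^sup>2)"
    by (simp add: sum_distrib_left sum.distrib[symmetric] sum_subtractf[symmetric]
        algebra_simps power_mult_distrib)
  finally have "ln ?S \<le> \<eta> * (- (\<Sum>i\<in>A. p i * y i) + \<eta> / 2 * (\<Sum>i\<in>A. p i * (y i)\<^sup>2))"
    using p by (simp add: algebra_simps power2_eq_square)
  then show ?thesis
    using \<open>0 < \<eta>\<close> by (simp add: field_simps)
qed

section \<open>Exponential weights and loss estimates within one round\<close>

lemma sum_exp_pos: "0 < (\<Sum>k\<in>UNIV. exp (c * (L :: real ^ 'n) $ k))"
  by (intro sum_pos) auto

lemma exp_weights_pos: "0 < exp_weights \<eta> (L :: real ^ 'n) i"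
  using sum_exp_pos[of "- \<eta>" L] unfolding exp_weights_def by simp

lemma sum_exp_weights: "(\<Sum>i\<in>UNIV. exp_weights \<eta> (L :: real ^ 'n) i) = 1"
  using sum_exp_pos[of "- \<eta>" L] unfolding exp_weights_def sum_divide_distrib[symmetric] by simp

text \<open>Turns the one-round change of the log-normalizer into the logarithm of a mean under the
  current weights.\<close>

lemma sum_exp_add:
  fixes L x :: "real ^ 'n"
  shows "(\<Sum>k\<in>UNIV. exp (- \<eta> * (L + x) $ k))
    = (\<Sum>k\<in>UNIV. exp (- \<eta> * L $ k)) * (\<Sum>k\<in>UNIV. exp_weights \<eta> L k * exp (- \<eta> * x $ k))"
  unfolding sum_distrib_left
proof (intro sum.cong refl)
  fix k
  show "exp (- \<eta> * (L + x) $ k)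
    = (\<Sum>k\<in>UNIV. exp (- \<eta> * L $ k)) * (exp_weights \<eta> L k * exp (- \<eta> * x $ k))"
    using sum_exp_pos[of "- \<eta>" L]
    by (simp add: exp_weights_def exp_add[symmetric] ring_distribs)
qed

text \<open>The increment of \<open>exp3lb_cum\<close> in one round, with the drawn expert
  \<open>i\<close> as an argument so that it can be averaged over the draw.\<close>

definition loss_estimate :: "real \<Rightarrow> real ^ 'n \<Rightarrow> real ^ 'n \<Rightarrow> real ^ 'n \<Rightarrow> 'n \<Rightarrow> real ^ 'n" where
  "loss_estimate \<eta> L l lam i = (\<chi> k. (l $ k - lam $ k) / exp_weights \<eta> L k
     * (if i = k then 1 else 0) + lam $ k)"

lemma exp3lb_cum_Suc:
  "exp3lb_cum \<eta> l lam I (Suc t) = exp3lb_cum \<eta> l lam I t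
     + loss_estimate \<eta> (exp3lb_cum \<eta> l lam I t) (l (Suc t)) (lam (Suc t)) (I (Suc t))"
  by (simp add: loss_estimate_def)

lemma exp3lb_cum_cong:
  "(\<And>u. 1 \<le> u \<Longrightarrow> u \<le> t \<Longrightarrow> I u = J u) \<Longrightarrow> exp3lb_cum \<eta> l lam I t = exp3lb_cum \<eta> l lam J t"
  by (induction t) auto

text \<open>Expert j is drawn with probability p_j, which cancels the importance weight 1/p_j and
  leaves s_j + \<lambda>_j.\<close>

lemma expectation_loss_estimate:
  fixes L l lam :: "real ^ 'n"
  shows "(\<Sum>i\<in>UNIV. exp_weights \<eta> L i * loss_estimate \<eta> L l lam i $ j) = l $ j"
proof -
  have "exp_weights \<eta> L i * loss_estimate \<eta> L l lam i $ j
      = (if i = j then l $ j - lam $ j else 0) + exp_weights \<eta> L i * lam $ j" for i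
    using exp_weights_pos[of \<eta> L j] by (simp add: loss_estimate_def distrib_left)
  then show ?thesis
    by (simp add: sum.distrib sum_distrib_right[symmetric] sum_exp_weights)
qed

lemma vec_range_bounds:
  fixes x :: "real ^ 'n"
  shows "(MIN j. x $ j) \<le> x $ i" and "x $ i - (MIN j. x $ j) \<le> vec_range x"
  by (auto simp: vec_range_def)

lemma norm_power2_vec: "(norm (x :: real ^ 'n))\<^sup>2 = (\<Sum>i\<in>UNIV. (x $ i)\<^sup>2)"
  by (simp add: norm_vec_def L2_set_def sum_nonneg)

text \<open>Holds for each draw \<open>i\<close> separately: the first two terms are minus the
  p-mean of the estimate, and s_i^2/p_i is the p-mean of the square of its importance-weighted
  part.\<close>

lemma ln_sum_exp_loss_estimate_le:
  fixes L l lam :: "real ^ 'n"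
  assumes le: "\<And>k. lam $ k \<le> l $ k" and "0 < \<eta>"
  shows "ln (\<Sum>k\<in>UNIV. exp_weights \<eta> L k * exp (- \<eta> * loss_estimate \<eta> L l lam i $ k)) / \<eta>
    \<le> - (l $ i - lam $ i) - (\<Sum>k\<in>UNIV. exp_weights \<eta> L k * lam $ k)
       + \<eta> * ((vec_range lam)\<^sup>2 + (l $ i - lam $ i)\<^sup>2 / exp_weights \<eta> L i)"
proof -
  define p where "p = exp_weights \<eta> L"
  define c where "c = (MIN k. lam $ k)"
  define s where "s = l $ i - lam $ i"
  define x where "x k = (if i = k then s / p i else 0)" for k
  define y where "y k = lam $ k - c + x k" for k
  have p: "0 < p k" for k by (simp add: p_def exp_weights_pos)
  have sum_p: "sum p UNIV = 1" by (simp add: p_def sum_exp_weights)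
  have c: "c \<le> lam $ k" "lam $ k - c \<le> vec_range lam" for k
    unfolding c_def by (rule vec_range_bounds)+
  have s: "0 \<le> s" using le by (simp add: s_def)
  have x: "0 \<le> x k" for k using s p[of i] by (auto simp: x_def)
  have y: "0 \<le> y k" for k using c x[of k] by (simp add: y_def)
  have est: "loss_estimate \<eta> L l lam i $ k = y k + c" for k
    by (simp add: loss_estimate_def y_def x_def s_def p_def)
  have sum_px: "(\<Sum>k\<in>UNIV. p k * x k) = s"
  proof -
    have "p k * x k = (if i = k then s else 0)" for k
      using p[of k] by (simp add: x_def)
    then show ?thesis by simp
  qed
  have sum_px2: "(\<Sum>k\<in>UNIV. p k * (x k)\<^sup>2) = s\<^sup>2 / p i"
  proof -
    have "p k * (x k)\<^sup>2 = (if i = k then s\<^sup>2 / p i else 0)" for k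
      using p[of k] by (simp add: x_def power2_eq_square)
    then show ?thesis by simp
  qed
  have sum_py: "(\<Sum>k\<in>UNIV. p k * y k) = (\<Sum>k\<in>UNIV. p k * lam $ k) - c + s"
  proof -
    have "(\<Sum>k\<in>UNIV. p k * y k)
        = (\<Sum>k\<in>UNIV. p k * lam $ k) - sum p UNIV * c + (\<Sum>k\<in>UNIV. p k * x k)"
      by (simp add: y_def algebra_simps sum.distrib sum_subtractf sum_distrib_left)
    then show ?thesis by (simp add: sum_p sum_px)
  qed
  have "(\<Sum>k\<in>UNIV. p k * (y k)\<^sup>2)
      \<le> (\<Sum>k\<in>UNIV. p k * (2 * (vec_range lam)\<^sup>2 + 2 * (x k)\<^sup>2))"
  proof (intro sum_mono mult_left_mono)
    fix k
    \<comment> \<open>With a = \<lambda>_k - c and b = x_k this is (a - b)^2 \<ge> 0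
      rearranged.\<close>
    have "(y k)\<^sup>2 \<le> 2 * (lam $ k - c)\<^sup>2 + 2 * (x k)\<^sup>2"
      using zero_le_power2[of "lam $ k - c - x k"]
      by (simp add: y_def power2_eq_square algebra_simps)
    also have "(lam $ k - c)\<^sup>2 \<le> (vec_range lam)\<^sup>2"
      using c by (intro power_mono) auto
    finally show "(y k)\<^sup>2 \<le> 2 * (vec_range lam)\<^sup>2 + 2 * (x k)\<^sup>2" by simp
  qed (use p less_imp_le in auto)
  also have "\<dots> = 2 * (vec_range lam)\<^sup>2 * sum p UNIV + 2 * (\<Sum>k\<in>UNIV. p k * (x k)\<^sup>2)"
    by (simp add: sum_distrib_left sum_distrib_right sum.distrib algebra_simps)
  finally have sum_py2: "(\<Sum>k\<in>UNIV. p k * (y k)\<^sup>2) \<le> 2 * ((vec_range lam)\<^sup>2 + s\<^sup>2 / p i)"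
    by (simp add: sum_p sum_px2)
  let ?S = "\<Sum>k\<in>UNIV. p k * exp (- \<eta> * y k)"
  have "0 < ?S" using p by (intro sum_pos) auto
  \<comment> \<open>The shift costs exactly -c after taking \<open>ln\<close> and dividing by
    \<eta>; the -c inside \<open>sum_py\<close> cancels it at the end.\<close>
  have "(\<Sum>k\<in>UNIV. p k * exp (- \<eta> * loss_estimate \<eta> L l lam i $ k)) = exp (- \<eta> * c) * ?S"
    by (simp add: est algebra_simps exp_add exp_diff sum_distrib_left exp_minus field_simps)
  then have "ln (\<Sum>k\<in>UNIV. p k * exp (- \<eta> * loss_estimate \<eta> L l lam i $ k)) / \<eta>
      = - c + ln ?S / \<eta>"
    using \<open>0 < ?S\<close> \<open>0 < \<eta>\<close> by (simp add: ln_mult field_simps)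
  also have "ln ?S / \<eta> \<le> - (\<Sum>k\<in>UNIV. p k * y k) + \<eta> / 2 * (\<Sum>k\<in>UNIV. p k * (y k)\<^sup>2)"
    using p y sum_p \<open>0 < \<eta>\<close> less_imp_le by (intro ln_sum_exp_le) auto
  also have "\<eta> / 2 * (\<Sum>k\<in>UNIV. p k * (y k)\<^sup>2)
      \<le> \<eta> / 2 * (2 * ((vec_range lam)\<^sup>2 + s\<^sup>2 / p i))"
    using sum_py2 \<open>0 < \<eta>\<close> by (intro mult_left_mono) auto
  also have "\<dots> = \<eta> * ((vec_range lam)\<^sup>2 + s\<^sup>2 / p i)"
    by simp
  finally show ?thesis
    by (simp add: sum_py p_def[symmetric] s_def[symmetric])
qed

section \<open>Expectations over the random draws\<close>

lemma finite_set_pmf_exp3lb_draws: "finite (set_pmf (exp3lb_draws \<eta> l lam t))"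
  by (induction t) auto

text \<open>Tower rule: condition on the first t draws. Finite support turns the expectations into
  finite sums.\<close>

lemma expectation_exp3lb_draws_Suc:
  fixes l lam :: "nat \<Rightarrow> real ^ 'n" and F :: "(nat \<Rightarrow> 'n) \<Rightarrow> real"
  shows "measure_pmf.expectation (exp3lb_draws \<eta> l lam (Suc t)) F
    = measure_pmf.expectation (exp3lb_draws \<eta> l lam t)
        (\<lambda>I. \<Sum>i\<in>UNIV. exp_weights \<eta> (exp3lb_cum \<eta> l lam I t) i * F (I(Suc t := i)))"
proof -
  let ?D = "exp3lb_draws \<eta> l lam t"
  have "measure_pmf.expectation (exp3lb_draws \<eta> l lam (Suc t)) F
    = (\<Sum>I\<in>set_pmf ?D. pmf ?D I *\<^sub>R measure_pmf.expectation
         (map_pmf (\<lambda>i. I(Suc t := i)) (exp_weights_pmf \<eta> (exp3lb_cum \<eta> l lam I t))) F)"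
    unfolding exp3lb_draws.simps
    by (rule pmf_expectation_bind) (auto simp: finite_set_pmf_exp3lb_draws)
  also have "\<dots> = measure_pmf.expectation ?D (\<lambda>I. measure_pmf.expectation
         (exp_weights_pmf \<eta> (exp3lb_cum \<eta> l lam I t)) (\<lambda>i. F (I(Suc t := i))))"
    by (subst integral_measure_pmf[of "set_pmf ?D"]) (auto simp: finite_set_pmf_exp3lb_draws)
  also have "\<dots> = measure_pmf.expectation ?D
        (\<lambda>I. \<Sum>i\<in>UNIV. exp_weights \<eta> (exp3lb_cum \<eta> l lam I t) i * F (I(Suc t := i)))"
    by (subst integral_measure_pmf[of UNIV]) (auto simp: pmf_exp_weights_pmf)
  finally show ?thesis .
qed

lemma integrable_exp3lb_draws:
  fixes F :: "(nat \<Rightarrow> 'n::finite) \<Rightarrow> real"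
  shows "integrable (measure_pmf (exp3lb_draws \<eta> l lam t)) F"
  by (rule integrable_measure_pmf_finite[OF finite_set_pmf_exp3lb_draws])

lemma expectation_exp3lb_cum:
  fixes l lam :: "nat \<Rightarrow> real ^ 'n"
  shows "measure_pmf.expectation (exp3lb_draws \<eta> l lam t) (\<lambda>I. exp3lb_cum \<eta> l lam I t $ j)
    = (\<Sum>u=1..t. l u $ j)"
proof (induction t)
  case (Suc t)
  let ?L = "\<lambda>I. exp3lb_cum \<eta> l lam I t"
  \<comment> \<open>Setting draw t + 1 leaves the estimates after round t, and so the current
    weights, unchanged.\<close>
  have "exp3lb_cum \<eta> l lam (I(Suc t := i)) (Suc t)
      = ?L I + loss_estimate \<eta> (?L I) (l (Suc t)) (lam (Suc t)) i" for I i
    using exp3lb_cum_cong[of t "I(Suc t := i)" I] by (simp only: exp3lb_cum_Suc) simp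
  then have "(\<Sum>i\<in>UNIV. exp_weights \<eta> (?L I) i * exp3lb_cum \<eta> l lam (I(Suc t := i)) (Suc t) $ j)
      = ?L I $ j + l (Suc t) $ j" for I
    by (simp add: distrib_left sum.distrib sum_distrib_right[symmetric] sum_exp_weights
        expectation_loss_estimate del: exp3lb_cum.simps)
  then show ?case
    unfolding expectation_exp3lb_draws_Suc
    by (simp add: Suc.IH integrable_exp3lb_draws del: exp3lb_cum.simps)
qed simp

section \<open>The potential argument and the regret bound\<close>

lemma expectation_potential_le:
  fixes l lam :: "nat \<Rightarrow> real ^ 'n"
  assumes "\<And>i u. 1 \<le> u \<Longrightarrow> u \<le> t \<Longrightarrow> lam u $ i \<le> l u $ i" and "0 < \<eta>"
  shows "measure_pmf.expectation (exp3lb_draws \<eta> l lam t)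
      (\<lambda>I. (\<Sum>u=1..t. l u $ I u) + ln (\<Sum>k\<in>UNIV. exp (- \<eta> * exp3lb_cum \<eta> l lam I t $ k)) / \<eta>)
    \<le> ln (real CARD('n)) / \<eta>
       + \<eta> * (quad_range lam t + (\<Sum>u=1..t. (norm (l u - lam u))\<^sup>2))"
  using assms(1)
proof (induction t)
  \<comment> \<open>With all estimates zero the normalizer is N, so the potential starts at ln N /
    \<eta>.\<close>
  case 0
  then show ?case by (simp add: quad_range_def)
next
  case (Suc t)
  let ?L = "\<lambda>I. exp3lb_cum \<eta> l lam I t"
  let ?W = "\<lambda>L :: real ^ 'n. \<Sum>k\<in>UNIV. exp (- \<eta> * L $ k)"
  let ?Phi = "\<lambda>t I. (\<Sum>u=1..t. l u $ I u) + ln (?W (exp3lb_cum \<eta> l lam I t)) / \<eta>"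
  let ?v = "(vec_range (lam (Suc t)))\<^sup>2 + (norm (l (Suc t) - lam (Suc t)))\<^sup>2"
  have step: "(\<Sum>i\<in>UNIV. exp_weights \<eta> (?L I) i * ?Phi (Suc t) (I(Suc t := i)))
      \<le> ?Phi t I + \<eta> * ?v" for I
  proof -
    define p where "p = exp_weights \<eta> (?L I)"
    define a where "a = (\<Sum>k\<in>UNIV. p k * lam (Suc t) $ k)"
    let ?s = "\<lambda>i. l (Suc t) $ i - lam (Suc t) $ i"
    have p: "0 < p i" for i by (simp add: p_def exp_weights_pos)
    have sum_p: "sum p UNIV = 1" by (simp add: p_def sum_exp_weights)
    \<comment> \<open>The learner's new loss l_i and the -s_i from the log-normalizer combine to
      \<lambda>_i.\<close>
    have "?Phi (Suc t) (I(Suc t := i))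
        \<le> ?Phi t I + (lam (Suc t) $ i - a + \<eta> * ((vec_range (lam (Suc t)))\<^sup>2 + (?s i)\<^sup>2 / p i))" for i
    proof -
      let ?x = "loss_estimate \<eta> (?L I) (l (Suc t)) (lam (Suc t)) i"
      let ?S = "\<Sum>k\<in>UNIV. p k * exp (- \<eta> * ?x $ k)"
      have "0 < ?S" using p by (intro sum_pos) auto
      have "exp3lb_cum \<eta> l lam (I(Suc t := i)) (Suc t) = ?L I + ?x"
        using exp3lb_cum_cong[of t "I(Suc t := i)" I] by (simp only: exp3lb_cum_Suc) simp
      then have "ln (?W (exp3lb_cum \<eta> l lam (I(Suc t := i)) (Suc t))) = ln (?W (?L I)) + ln ?S"
        using \<open>0 < ?S\<close> sum_exp_pos[of "- \<eta>" "?L I"]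
        by (simp only: sum_exp_add p_def[symmetric] ln_mult_pos)
      moreover have "ln ?S / \<eta> \<le> - ?s i - a + \<eta> * ((vec_range (lam (Suc t)))\<^sup>2 + (?s i)\<^sup>2 / p i)"
        unfolding a_def p_def using Suc.prems \<open>0 < \<eta>\<close>
        by (intro ln_sum_exp_loss_estimate_le) auto
      moreover have "(\<Sum>u=1..Suc t. l u $ (I(Suc t := i)) u)
          = (\<Sum>u=1..t. l u $ I u) + l (Suc t) $ i"
        by simp
      ultimately show ?thesis
        by (simp only: add_divide_distrib)
    qed
    then have "(\<Sum>i\<in>UNIV. p i * ?Phi (Suc t) (I(Suc t := i)))
        \<le> (\<Sum>i\<in>UNIV. p i * (?Phi t I + (lam (Suc t) $ i - a
              + \<eta> * ((vec_range (lam (Suc t)))\<^sup>2 + (?s i)\<^sup>2 / p i))))"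
      using p less_imp_le by (intro sum_mono mult_left_mono) auto
    \<comment> \<open>The factor p_i removes the denominator of s_i^2/p_i, which is how the
      unweighted squared norm arises. Since \<open>a\<close> is the p-mean of \<lambda>, the terms
      \<lambda>_i - a then average to zero.\<close>
    also have "\<dots> = (\<Sum>i\<in>UNIV. p i * (?Phi t I - a + \<eta> * (vec_range (lam (Suc t)))\<^sup>2)
        + p i * lam (Suc t) $ i + \<eta> * (?s i)\<^sup>2)"
    proof (intro sum.cong refl)
      fix i
      show "p i * (?Phi t I + (lam (Suc t) $ i - a
              + \<eta> * ((vec_range (lam (Suc t)))\<^sup>2 + (?s i)\<^sup>2 / p i)))
        = p i * (?Phi t I - a + \<eta> * (vec_range (lam (Suc t)))\<^sup>2)
            + p i * lam (Suc t) $ i + \<eta> * (?s i)\<^sup>2"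
        using p[of i] by (simp add: algebra_simps)
    qed
    also have "\<dots> = sum p UNIV * (?Phi t I - a + \<eta> * (vec_range (lam (Suc t)))\<^sup>2)
        + a + \<eta> * (\<Sum>i\<in>UNIV. (?s i)\<^sup>2)"
      by (simp only: sum.distrib sum_distrib_left sum_distrib_right a_def)
    also have "\<dots> = ?Phi t I + \<eta> * ?v"
      by (simp add: sum_p norm_power2_vec algebra_simps)
    finally show ?thesis unfolding p_def .
  qed
  have "measure_pmf.expectation (exp3lb_draws \<eta> l lam (Suc t)) (?Phi (Suc t))
      \<le> measure_pmf.expectation (exp3lb_draws \<eta> l lam t) (\<lambda>I. ?Phi t I + \<eta> * ?v)"
    unfolding expectation_exp3lb_draws_Suc
    by (intro integral_mono integrable_exp3lb_draws step)
  also have "\<dots> = measure_pmf.expectation (exp3lb_draws \<eta> l lam t) (?Phi t) + \<eta> * ?v"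
    by (subst Bochner_Integration.integral_add) (simp_all add: integrable_exp3lb_draws)
  also have "\<dots> \<le> ln (real CARD('n)) / \<eta>
      + \<eta> * (quad_range lam t + (\<Sum>u=1..t. (norm (l u - lam u))\<^sup>2)) + \<eta> * ?v"
    using Suc.IH Suc.prems by auto
  also have "\<dots> = ln (real CARD('n)) / \<eta>
      + \<eta> * (quad_range lam (Suc t) + (\<Sum>u=1..Suc t. (norm (l u - lam u))\<^sup>2))"
    by (simp add: quad_range_def algebra_simps)
  finally show ?case .
qed

lemma expectation_regret_le:
  fixes l lam :: "nat \<Rightarrow> real ^ 'n"
  assumes "\<And>i t. 1 \<le> t \<Longrightarrow> t \<le> T \<Longrightarrow> lam t $ i \<le> l t $ i" and "0 < \<eta>"
  shows "measure_pmf.expectation (exp3lb_draws \<eta> l lam T) (regret l T)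
    \<le> ln (real CARD('n)) / \<eta>
       + \<eta> * (quad_range lam T + (\<Sum>t=1..T. (norm (l t - lam t))\<^sup>2))"
proof -
  let ?E = "measure_pmf.expectation (exp3lb_draws \<eta> l lam T)"
  let ?L = "\<lambda>I. exp3lb_cum \<eta> l lam I T"
  let ?W = "\<lambda>I. \<Sum>k\<in>UNIV. exp (- \<eta> * ?L I $ k)"
  \<comment> \<open>The losses are fixed in advance, so the best expert j does not depend on the
    draws and unbiasedness applies to its coordinate.\<close>
  have "(MIN j. \<Sum>t=1..T. l t $ j) \<in> range (\<lambda>j. \<Sum>t=1..T. l t $ j)"
    by (intro Min_in) auto
  then obtain j where j: "(MIN j. \<Sum>t=1..T. l t $ j) = (\<Sum>t=1..T. l t $ j)"
    by (rule rangeE)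
  have "(\<Sum>t=1..T. l t $ I t) - ?L I $ j \<le> (\<Sum>t=1..T. l t $ I t) + ln (?W I) / \<eta>" for I
  proof -
    have "exp (- \<eta> * ?L I $ j) \<le> ?W I"
      by (rule member_le_sum) auto
    then have "- \<eta> * ?L I $ j \<le> ln (?W I)"
      using sum_exp_pos[of "- \<eta>" "?L I"] by (subst ln_ge_iff) auto
    then show ?thesis using \<open>0 < \<eta>\<close> by (simp add: field_simps)
  qed
  then have "?E (\<lambda>I. (\<Sum>t=1..T. l t $ I t) - ?L I $ j)
      \<le> ?E (\<lambda>I. (\<Sum>t=1..T. l t $ I t) + ln (?W I) / \<eta>)"
    by (intro integral_mono integrable_exp3lb_draws)
  moreover have "?E (\<lambda>I. (\<Sum>t=1..T. l t $ I t) - ?L I $ j)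
      = ?E (\<lambda>I. \<Sum>t=1..T. l t $ I t) - (\<Sum>t=1..T. l t $ j)"
    by (subst Bochner_Integration.integral_diff)
      (simp_all add: integrable_exp3lb_draws expectation_exp3lb_cum)
  moreover have "?E (regret l T) = ?E (\<lambda>I. \<Sum>t=1..T. l t $ I t) - (\<Sum>t=1..T. l t $ j)"
    unfolding regret_def j
    by (subst Bochner_Integration.integral_diff) (simp_all add: integrable_exp3lb_draws)
  ultimately show ?thesis
    using expectation_potential_le[of T lam l \<eta>, OF assms] by linarith
qed

theorem corollary2:
  fixes l lam :: "nat \<Rightarrow> real ^ 'n" and T :: nat and Q' :: real
  assumes "CARD('n) \<ge> 2" and "T \<ge> 1"
    and "\<And>i t. 1 \<le> t \<Longrightarrow> t \<le> T \<Longrightarrow> lam t $ i \<le> l t $ i"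
    and "Q' > 0"
    and "4 * (quad_range lam T + (\<Sum>t=1..T. (norm (l t - lam t))\<^sup>2)) \<le> Q'"
  shows "measure_pmf.expectation
           (exp3lb_draws (sqrt (4 * ln (real CARD('n)) / Q')) l lam T) (regret l T)
         \<le> sqrt (Q' * ln (real CARD('n)))"
proof -
  define m where "m = ln (real CARD('n))"
  define \<eta> where "\<eta> = sqrt (4 * m / Q')"
  \<comment> \<open>Two experts suffice for ln N > 0, which makes \<eta> positive.\<close>
  have m: "0 < m" using assms(1) by (simp add: m_def)
  have \<eta>: "0 < \<eta>" using m \<open>Q' > 0\<close> by (simp add: \<eta>_def)
  \<comment> \<open>By \<open>root\<close> and \<open>sq\<close> the two terms m / \<eta> and \<eta>
    Q' / 4 coincide, each being half of sqrt (Q' m).\<close>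
  have root: "\<eta> * sqrt (Q' * m) = 2 * m"
    using m \<open>Q' > 0\<close> by (simp add: \<eta>_def real_sqrt_mult real_sqrt_divide)
  have "\<eta> * \<eta> = 4 * m / Q'" using m \<open>Q' > 0\<close> by (simp add: \<eta>_def)
  then have sq: "\<eta> * (Q' / 4) = m / \<eta>" using \<eta> \<open>Q' > 0\<close> by (simp add: field_simps)
  have "measure_pmf.expectation (exp3lb_draws \<eta> l lam T) (regret l T)
      \<le> m / \<eta> + \<eta> * (quad_range lam T + (\<Sum>t=1..T. (norm (l t - lam t))\<^sup>2))"
    unfolding m_def by (rule expectation_regret_le[OF assms(3) \<eta>])
  also have "\<dots> \<le> m / \<eta> + \<eta> * (Q' / 4)"
    using assms(5) \<eta> by (intro add_left_mono mult_left_mono) auto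
  also have "\<dots> = sqrt (Q' * m)"
    unfolding sq using root \<eta> by (simp add: field_simps)
  finally show ?thesis unfolding \<eta>_def m_def .
qed

end
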